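(* For $\lambda\in\mathbb{C}$ let $d_\lambda\colon\mathbb{C}(x)\to\mathbb{C}(x)$ be the derivation of weight $\lambda$ on the field of complex rational functions defined by $$d_\lambda(f)(x)=\frac{f(x+\lambda)-f(x)}{\lambda}\ \text{ if }\lambda\neq0,\qquad d_0(f)(x)=f'(x).$$ Then for every $\lambda\in\mathbb{C}$ the derivation $d_\lambda$ is regular, i.e. $(\mathbb{C}(x),d_\lambda)$ is a regular differential $\mathbb{C}$-algebra of weight $\lambda$. In particular, the difference operator $f(x)\mapsto f(x+1)-f(x)$ on $\mathbb{C}(x)$ is a regular derivation of weight one.
   Context: A derivation of weight $\lambda$ on a unitary $\mathbf{k}$-algebra $A$ is a $\mathbf{k}$-linear map $d$ with $d(1)=0$ and $d(xy)=d(x)y+xd(y)+\lambda d(x)d(y)$ for all $x,y\in A$; then $(A,d)$ is a differential algebra of weight $\lambda$. A quasi-inverse of a $\mathbf{k}$-linear map $L\colon M\to N$ is a $\mathbf{k}$-linear map $\bar L\colon N\to M$ with $L\bar LL=L$ and $\bar LL\bar L=\bar L$. A differential algebra $(A,d)$ of weight $\lambda$ is called regular if $d$ has a quasi-inverse which, in case $\lambda\neq0$, can moreover be chosen such that its kernel is a nonunitary $\mathbf{k}$-subalgebra of $A$ (closed under multiplication, not required to contain $1$). Here $\mathbf{k}=\mathbb{C}$. *)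

theory Defs
  imports
    "HOL-Computational_Algebra.Computational_Algebra"
    "HOL-Computational_Algebra.Field_as_Ring"
begin

section \<open>Differential algebras of weight \<open>\<lambda>\<close>\<close>

locale unitary_algebra = module scale
  for scale :: "'k::comm_ring_1 \<Rightarrow> 'a::ring_1 \<Rightarrow> 'a" +
  assumes scale_mult_left: "scale c x * y = scale c (x * y)"
    and scale_mult_right: "x * scale c y = scale c (x * y)"

definition derivation :: "('k::comm_ring_1 \<Rightarrow> 'a::ring_1 \<Rightarrow> 'a) \<Rightarrow> 'k \<Rightarrow> ('a \<Rightarrow> 'a) \<Rightarrow> bool" where
  "derivation scale l d \<longleftrightarrow>
     module_hom scale scale d \<and> d 1 = 0 \<and>
     (\<forall>x y. d (x * y) = d x * y + x * d y + scale l (d x * d y))"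

definition differential_algebra ::
    "('k::comm_ring_1 \<Rightarrow> 'a::ring_1 \<Rightarrow> 'a) \<Rightarrow> 'k \<Rightarrow> ('a \<Rightarrow> 'a) \<Rightarrow> bool" where
  "differential_algebra scale l d \<longleftrightarrow> unitary_algebra scale \<and> derivation scale l d"

definition quasi_inverse ::
    "('k::comm_ring_1 \<Rightarrow> 'm::ab_group_add \<Rightarrow> 'm) \<Rightarrow> ('k \<Rightarrow> 'n::ab_group_add \<Rightarrow> 'n)
      \<Rightarrow> ('m \<Rightarrow> 'n) \<Rightarrow> ('n \<Rightarrow> 'm) \<Rightarrow> bool" where
  "quasi_inverse scaleM scaleN L L' \<longleftrightarrow>
     module_hom scaleN scaleM L' \<and> L \<circ> L' \<circ> L = L \<and> L' \<circ> L \<circ> L' = L'"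

definition nonunitary_subalgebra ::
    "('k::comm_ring_1 \<Rightarrow> 'a::ring_1 \<Rightarrow> 'a) \<Rightarrow> 'a set \<Rightarrow> bool" where
  "nonunitary_subalgebra scale S \<longleftrightarrow>
     module.subspace scale S \<and> (\<forall>x\<in>S. \<forall>y\<in>S. x * y \<in> S)"

definition regular_differential_algebra ::
    "('k::comm_ring_1 \<Rightarrow> 'a::ring_1 \<Rightarrow> 'a) \<Rightarrow> 'k \<Rightarrow> ('a \<Rightarrow> 'a) \<Rightarrow> bool" where
  "regular_differential_algebra scale l d \<longleftrightarrow>
     differential_algebra scale l d \<and>
     (\<exists>q. quasi_inverse scale scale d q \<and>
          (l \<noteq> 0 \<longrightarrow> nonunitary_subalgebra scale {x. q x = 0}))"


section \<open>Complex rational functions\<close>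

type_synonym ratfun = "complex poly fract"

definition rf_scale :: "complex \<Rightarrow> ratfun \<Rightarrow> ratfun" where
  "rf_scale c f = to_fract [:c:] * f"

lemma pcompose_translate_eq_0_iff [simp]:
  "pcompose p [:l, 1:] = 0 \<longleftrightarrow> p = 0" for p :: "complex poly"
  by (simp add: pcompose_eq_0_iff)

text \<open>
  The two operations below are computed on the numerator and denominator in lowest terms
  (\<^const>\<open>quot_of_fract\<close>); the lemmas \<open>rf_shift_Fract\<close> and \<open>rf_deriv_Fract\<close> show that
  any other representation as a fraction gives the same result.
\<close>

text \<open>\<open>f(x) \<mapsto> f(x + l)\<close>\<close>
definition rf_shift :: "complex \<Rightarrow> ratfun \<Rightarrow> ratfun" where
  "rf_shift l f =
     (case quot_of_fract f of (p, q) \<Rightarrow> Fract (pcompose p [:l, 1:]) (pcompose q [:l, 1:]))"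

text \<open>\<open>f \<mapsto> f'\<close>\<close>
definition rf_deriv :: "ratfun \<Rightarrow> ratfun" where
  "rf_deriv f =
     (case quot_of_fract f of (p, q) \<Rightarrow> Fract (pderiv p * q - p * pderiv q) (q\<^sup>2))"

lemma ratfun_lowest_terms:
  fixes f :: ratfun
  obtains p q where "quot_of_fract f = (p, q)" "q \<noteq> 0" "f = Fract p q"
proof (cases "quot_of_fract f")
  case (Pair p q)
  have "q \<noteq> 0"
    using snd_quot_of_fract_nonzero[of f] Pair by simp
  moreover have "f = Fract p q"
    using quot_to_fract_quot_of_fract[of f] Pair by (simp add: quot_to_fract_def)
  ultimately show ?thesis
    using Pair that by blast
qed

lemma rf_shift_Fract:
  assumes "q \<noteq> 0"
  shows "rf_shift l (Fract p q) = Fract (pcompose p [:l, 1:]) (pcompose q [:l, 1:])"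
proof -
  obtain a b where ab: "quot_of_fract (Fract p q) = (a, b)" "b \<noteq> 0" "Fract p q = Fract a b"
    by (rule ratfun_lowest_terms)
  then have "p * b = a * q"
    using assms by (simp add: eq_fract)
  then have "pcompose a [:l, 1:] * pcompose q [:l, 1:] = pcompose p [:l, 1:] * pcompose b [:l, 1:]"
    by (simp flip: pcompose_mult)
  then show ?thesis
    using ab(1,2) assms by (simp add: rf_shift_def eq_fract)
qed

lemma rf_deriv_Fract:
  assumes "q \<noteq> 0"
  shows "rf_deriv (Fract p q) = Fract (pderiv p * q - p * pderiv q) (q\<^sup>2)"
proof -
  obtain a b where ab: "quot_of_fract (Fract p q) = (a, b)" "b \<noteq> 0" "Fract p q = Fract a b"
    by (rule ratfun_lowest_terms)
  then have eq: "a * q = p * b"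
    using assms by (simp add: eq_fract)
  have "a * pderiv q + q * pderiv a = p * pderiv b + b * pderiv p"
    using arg_cong[OF eq, of pderiv] by (simp only: pderiv_mult)
  with eq have "(pderiv a * b - a * pderiv b) * q\<^sup>2 = (pderiv p * q - p * pderiv q) * b\<^sup>2"
    by algebra
  then show ?thesis
    using ab(1,2) assms by (simp add: rf_deriv_def eq_fract)
qed

definition rf_d :: "complex \<Rightarrow> ratfun \<Rightarrow> ratfun" where
  "rf_d l f = (if l = 0 then rf_deriv f else rf_scale (inverse l) (rf_shift l f - f))"

end

(* For l ~= 0 the image of f(x + l) - f(x) has an explicit complement that is closed under
   multiplication: the proper fractions all of whose poles lie in a fixed set of representatives
   of C / lZ.  Every fraction is congruent to one of these modulo the image, because polynomials
   are differences, a partial fraction splitting separates the poles, and each pole can be shifted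
   along its orbit.  A projection along this complement, followed by a linear section of the
   operator, is a quasi-inverse whose kernel is the complement. *)
theory Submission
  imports Defs
begin

section \<open>Quasi-inverses of linear operators\<close>

text \<open>Over a field, \<open>d\<close> has a linear right inverse \<open>s\<close> on its range,
  so \<open>d s d = d\<close>.\<close>

lemma quasi_inverse_exists:
  fixes scale :: "'k::field \<Rightarrow> 'a::ab_group_add \<Rightarrow> 'a"
  assumes "vector_space scale" and d: "module_hom scale scale d"
  shows "\<exists>q. quasi_inverse scale scale d q"
proof -
  interpret vector_space scale by fact
  interpret vector_space_pair scale scale ..
  obtain s where s: "Vector_Spaces.linear scale scale s" "\<And>x. d (s (d x)) = d x"
    using linear_exists_right_inverse_on[of d UNIV] d
    by (auto simp: linear_iff_module_hom)
  \<comment> \<open>Off the range of \<open>d\<close>, \<open>s\<close> may violate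
    \<open>s d s = s\<close>; the sandwich \<open>s d s\<close> satisfies both identities.\<close>
  have "module_hom scale scale (s \<circ> d \<circ> s)"
    using d s(1) by (auto simp: linear_iff_module_hom intro!: module_hom_compose)
  then show ?thesis
    using s(2) by (intro exI[of _ "s \<circ> d \<circ> s"]) (auto simp: quasi_inverse_def fun_eq_iff)
qed

text \<open>The last two assumptions make \<open>W\<close> a complement of the range of
  \<open>d\<close>. Projecting onto the range along \<open>W\<close> and then applying a section
  \<open>s\<close>, which is injective on the range, gives a map with kernel
  \<open>W\<close>.\<close>

lemma quasi_inverse_with_kernel:
  fixes scale :: "'k::field \<Rightarrow> 'a::ab_group_add \<Rightarrow> 'a"
  assumes "vector_space scale" and d: "module_hom scale scale d"
    and W: "module.subspace scale W"
    and sum: "\<And>x. \<exists>y. x - d y \<in> W"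
    and direct: "\<And>y. d y \<in> W \<Longrightarrow> d y = 0"
  shows "\<exists>q. quasi_inverse scale scale d q \<and> {x. q x = 0} = W"
proof -
  interpret vector_space scale by fact
  interpret vector_space_pair scale scale ..
  interpret d: module_hom scale scale d by fact
  obtain s where s: "Vector_Spaces.linear scale scale s" "\<And>x. d (s (d x)) = d x"
    using linear_exists_right_inverse_on[of d UNIV] d
    by (auto simp: linear_iff_module_hom)
  interpret s: module_hom scale scale s
    using s(1) by (simp add: linear_iff_module_hom)
  obtain g where g: "\<And>x. x - d (g x) \<in> W"
    using sum by metis
  \<comment> \<open>The choice \<open>g\<close> need not be linear, but \<open>d (g x)\<close> is
    the range component of \<open>x\<close>, unique by directness. This uniqueness yields
    linearity.\<close>
  have dg: "d (g x) = d y" if "x - d y \<in> W" for x y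
  proof -
    have "d (g x - y) \<in> W"
      using subspace_diff[OF W that g[of x]] by (simp add: d.diff)
    from direct[OF this] show ?thesis by (simp add: d.diff)
  qed
  have "d (g (x + y)) = d (g x) + d (g y)" for x y
    using dg[of "x + y" "g x + g y"] subspace_add[OF W g[of x] g[of y]]
    by (simp add: d.add algebra_simps)
  moreover have "d (g (scale c x)) = scale c (d (g x))" for c x
    using dg[of "scale c x" "scale c (g x)"] subspace_scale[OF W g[of x]]
    by (simp add: d.scale scale_right_diff_distrib)
  ultimately have "module_hom scale scale (\<lambda>x. s (d (g x)))"
    by (auto simp: module_hom_iff s.add s.scale module_axioms)
  moreover have "d (g (d x)) = d x" for x
    using dg[of "d x" x] subspace_0[OF W] by simp
  ultimately have "quasi_inverse scale scale d (\<lambda>x. s (d (g x)))"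
    using s(2) by (auto simp: quasi_inverse_def fun_eq_iff)
  moreover have "s (d (g x)) = 0 \<longleftrightarrow> x \<in> W" for x
  proof
    assume "s (d (g x)) = 0"
    then have "d (g x) = 0" using s(2)[of "g x"] by simp
    then show "x \<in> W" using g[of x] by simp
  next
    assume "x \<in> W"
    then have "d (g x) = d 0" by (intro dg) simp
    then show "s (d (g x)) = 0" by simp
  qed
  ultimately show ?thesis by blast
qed


section \<open>The shift and the derivative on rational functions\<close>

declare pcompose_1 [simp]

lemma rf_scale_Fract: "rf_scale c (Fract p q) = Fract (smult c p) q"
  by (simp add: rf_scale_def to_fract_def)

interpretation rf: vector_space rf_scale
proof
  have "to_fract [:a + b:] = to_fract [:a:] + to_fract [:b:]" for a b :: complex
    by (simp flip: to_fract_add)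
  then show "rf_scale (a + b) f = rf_scale a f + rf_scale b f" for a b f
    by (simp add: rf_scale_def algebra_simps)
  have "to_fract [:a * b:] = to_fract [:a:] * to_fract [:b:]" for a b :: complex
    by (simp flip: to_fract_mult)
  then show "rf_scale a (rf_scale b f) = rf_scale (a * b) f" for a b f
    by (simp add: rf_scale_def)
qed (simp_all add: rf_scale_def algebra_simps flip: one_pCons)

lemma unitary_algebra_rf_scale: "unitary_algebra rf_scale"
  by unfold_locales (simp_all add: rf_scale_def algebra_simps)

lemma rf_shift_add: "rf_shift l (f + g) = rf_shift l f + rf_shift l g"
  by (cases f; cases g) (simp add: rf_shift_Fract pcompose_add pcompose_mult)

lemma rf_shift_mult: "rf_shift l (f * g) = rf_shift l f * rf_shift l g"
  by (cases f; cases g) (simp add: rf_shift_Fract pcompose_mult)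

lemma rf_shift_scale: "rf_shift l (rf_scale c f) = rf_scale c (rf_shift l f)"
  by (cases f) (simp add: rf_shift_Fract rf_scale_Fract pcompose_smult)

lemma rf_shift_1 [simp]: "rf_shift l 1 = 1"
  by (simp add: rf_shift_Fract One_fract_def)

lemma rf_shift_diff: "rf_shift l (f - g) = rf_shift l f - rf_shift l g"
  using rf_shift_add[of l "f - g" g] by simp

lemma rf_shift_of_0 [simp]: "rf_shift l 0 = 0"
  using rf_shift_diff[of l 0 0] by simp

lemma rf_shift_0 [simp]: "rf_shift 0 f = f"
  by (cases f) (simp add: rf_shift_Fract)

lemma rf_shift_rf_shift: "rf_shift k (rf_shift l f) = rf_shift (k + l) f"
proof -
  have "pcompose [:l, 1:] [:k, 1:] = [:k + l, 1:]"
    by (simp add: pcompose_pCons add.commute)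
  then show ?thesis
    by (cases f) (simp add: rf_shift_Fract flip: pcompose_assoc)
qed

section \<open>Derivation laws\<close>

lemma rf_deriv_add: "rf_deriv (f + g) = rf_deriv f + rf_deriv g"
proof (cases f; cases g)
  fix a b p q assume "f = Fract a b" "b \<noteq> 0" "g = Fract p q" "q \<noteq> 0"
  then show ?thesis
    by (simp add: rf_deriv_Fract eq_fract pderiv_add pderiv_mult)
      (simp add: algebra_simps power2_eq_square)
qed

lemma rf_deriv_mult: "rf_deriv (f * g) = rf_deriv f * g + f * rf_deriv g"
proof (cases f; cases g)
  fix a b p q assume "f = Fract a b" "b \<noteq> 0" "g = Fract p q" "q \<noteq> 0"
  then show ?thesis
    by (simp add: rf_deriv_Fract eq_fract pderiv_mult)
      (simp add: algebra_simps power2_eq_square)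
qed

lemma rf_deriv_scale: "rf_deriv (rf_scale c f) = rf_scale c (rf_deriv f)"
  by (cases f) (simp add: rf_deriv_Fract rf_scale_Fract pderiv_smult smult_diff_right)

lemma rf_deriv_1 [simp]: "rf_deriv 1 = 0"
  by (simp add: One_fract_def rf_deriv_Fract Zero_fract_def)

text \<open>For \<open>l \<noteq> 0\<close> the shift is the identity plus \<open>l\<close> times
  \<open>rf_d l\<close>; its multiplicativity is the product rule of weight
  \<open>l\<close>.\<close>

lemma differential_algebra_rf_d: "differential_algebra rf_scale l (rf_d l)"
proof (cases "l = 0")
  case True
  then show ?thesis
    by (simp add: differential_algebra_def derivation_def unitary_algebra_rf_scale module_hom_iff
        rf.module_axioms rf_d_def rf_deriv_add rf_deriv_scale rf_deriv_mult)
next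
  case False
  define i where "i = to_fract [:inverse l:]"
  define L where "L = to_fract [:l:]"
  have iL: "L * i = 1"
    using False by (simp add: i_def L_def pCons_one flip: to_fract_mult)
  have d: "rf_d l = (\<lambda>f. i * (rf_shift l f - f))"
    using False by (simp add: rf_d_def fun_eq_iff rf_scale_def i_def)
  have "rf_d l (x * y) = rf_d l x * y + x * rf_d l y + rf_scale l (rf_d l x * rf_d l y)" for x y
    unfolding d rf_shift_mult rf_scale_def L_def[symmetric] using iL by algebra
  moreover have "rf_d l (rf_scale c x) = rf_scale c (rf_d l x)" for c x
    by (simp add: d rf_shift_scale) (simp add: rf_scale_def algebra_simps)
  ultimately show ?thesis
    by (simp add: differential_algebra_def derivation_def unitary_algebra_rf_scale module_hom_iff
        rf.module_axioms) (simp add: d rf_shift_add algebra_simps)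
qed


section \<open>Proper fractions with prescribed poles\<close>

text \<open>Any representation may witness membership, so sums and products need no reduction to
  lowest terms. The disjunct \<open>p = 0\<close> admits zero over a constant denominator.\<close>

definition proper_fractions :: "complex set \<Rightarrow> ratfun set" where
  "proper_fractions T = {Fract p q |p q.
     q \<noteq> 0 \<and> (p = 0 \<or> degree p < degree q) \<and> (\<forall>a. poly q a = 0 \<longrightarrow> a \<in> T)}"

lemma Fract_in_proper_fractions:
  assumes "q \<noteq> 0" "p = 0 \<or> degree p < degree q" "\<And>a. poly q a = 0 \<Longrightarrow> a \<in> T"
  shows "Fract p q \<in> proper_fractions T"
  using assms by (auto simp: proper_fractions_def)

lemma proper_fractionsE:
  assumes "f \<in> proper_fractions T"
  obtains p q where "f = Fract p q" "q \<noteq> 0" "p = 0 \<or> degree p < degree q"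
    "\<And>a. poly q a = 0 \<Longrightarrow> a \<in> T"
  using assms by (auto simp: proper_fractions_def)

text \<open>Negative degree (numerator minus denominator) survives sums and products, and a product
  of denominators has no new roots. The unit has degree 0 and stays outside.\<close>

lemma nonunitary_subalgebra_proper_fractions:
  "nonunitary_subalgebra rf_scale (proper_fractions T)"
  unfolding nonunitary_subalgebra_def rf.subspace_def
proof (intro conjI ballI allI)
  show "0 \<in> proper_fractions T"
    unfolding Zero_fract_def by (rule Fract_in_proper_fractions) auto
next
  fix f g assume "f \<in> proper_fractions T" "g \<in> proper_fractions T"
  then obtain a b p q where f: "f = Fract a b" "b \<noteq> 0" "a = 0 \<or> degree a < degree b"
      "\<And>x. poly b x = 0 \<Longrightarrow> x \<in> T"
    and g: "g = Fract p q" "q \<noteq> 0" "p = 0 \<or> degree p < degree q"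
      "\<And>x. poly q x = 0 \<Longrightarrow> x \<in> T"
    by (metis proper_fractionsE)
  have "degree (a * q) < degree (b * q)" if "a \<noteq> 0"
    using that f g by (auto simp: degree_mult_eq)
  moreover have "degree (p * b) < degree (b * q)" if "p \<noteq> 0"
    using that f g by (auto simp: degree_mult_eq)
  ultimately have "a * q + p * b = 0 \<or> degree (a * q + p * b) < degree (b * q)"
    by (cases "a = 0"; cases "p = 0") (auto intro: degree_add_less)
  then have "Fract (a * q + p * b) (b * q) \<in> proper_fractions T"
    using f g by (intro Fract_in_proper_fractions) auto
  then show "f + g \<in> proper_fractions T"
    using f g by simp
  have "a * p = 0 \<or> degree (a * p) < degree (b * q)"
    using f g by (cases "a = 0"; cases "p = 0") (auto simp: degree_mult_eq)
  then show "f * g \<in> proper_fractions T"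
    unfolding f g mult_fract using f g by (intro Fract_in_proper_fractions) auto
next
  fix c f assume "f \<in> proper_fractions T"
  then obtain p q where f: "f = Fract p q" "q \<noteq> 0" "p = 0 \<or> degree p < degree q"
      "\<And>x. poly q x = 0 \<Longrightarrow> x \<in> T"
    by (metis proper_fractionsE)
  then show "rf_scale c f \<in> proper_fractions T"
    unfolding f rf_scale_Fract by (intro Fract_in_proper_fractions) auto
qed

lemma polynomial_proper_fraction_eq_0:
  assumes "Fract s 1 \<in> proper_fractions T"
  shows "s = 0"
proof -
  obtain p q where "Fract s 1 = Fract p q" "q \<noteq> 0" "p = 0 \<or> degree p < degree q"
    using assms by (metis proper_fractionsE)
  then show ?thesis
    by (cases "s = 0") (auto simp: eq_fract degree_mult_eq)
qed


section \<open>Poles\<close>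

text \<open>The negation says that \<open>a\<close> is a pole. Since
  \<open>poly q a \<noteq> 0\<close> forces \<open>q \<noteq> 0\<close>, the default value of
  \<open>Fract p 0\<close> does not interfere.\<close>

definition rf_regular_at :: "complex \<Rightarrow> ratfun \<Rightarrow> bool" where
  "rf_regular_at a f \<longleftrightarrow> (\<exists>p q. f = Fract p q \<and> poly q a \<noteq> 0)"

lemma rf_regular_at_add:
  assumes "rf_regular_at a f" "rf_regular_at a g"
  shows "rf_regular_at a (f + g)"
proof -
  obtain p q r s where "f = Fract p q" "g = Fract r s" and nz: "poly q a \<noteq> 0" "poly s a \<noteq> 0"
    using assms by (auto simp: rf_regular_at_def)
  moreover have "q \<noteq> 0" "s \<noteq> 0" using nz by auto
  ultimately have "f + g = Fract (p * s + r * q) (q * s)" "poly (q * s) a \<noteq> 0"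
    by auto
  then show ?thesis unfolding rf_regular_at_def by blast
qed

lemma rf_regular_at_uminus: "rf_regular_at a f \<Longrightarrow> rf_regular_at a (- f)"
  unfolding rf_regular_at_def by (metis minus_fract)

lemma rf_regular_at_diff:
  "rf_regular_at a f \<Longrightarrow> rf_regular_at a g \<Longrightarrow> rf_regular_at a (f - g)"
  using rf_regular_at_add[of a f "- g"] rf_regular_at_uminus[of a g] by simp

lemma rf_regular_at_shift_imp:
  assumes "rf_regular_at (a + l) f"
  shows "rf_regular_at a (rf_shift l f)"
proof -
  obtain p q where f: "f = Fract p q" and nz: "poly q (a + l) \<noteq> 0"
    using assms by (auto simp: rf_regular_at_def)
  have "q \<noteq> 0" using nz by auto
  moreover have "poly (pcompose q [:l, 1:]) a \<noteq> 0"
    using nz by (simp add: poly_pcompose add.commute)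
  ultimately show ?thesis
    unfolding f rf_regular_at_def by (metis rf_shift_Fract)
qed

lemma rf_regular_at_shift: "rf_regular_at a (rf_shift l f) \<longleftrightarrow> rf_regular_at (a + l) f"
  using rf_regular_at_shift_imp[of a l f] rf_regular_at_shift_imp[of "a + l" "- l" "rf_shift l f"]
  by (auto simp: rf_shift_rf_shift)

lemma rf_regular_at_proper_fraction:
  "f \<in> proper_fractions T \<Longrightarrow> a \<notin> T \<Longrightarrow> rf_regular_at a f"
  unfolding rf_regular_at_def by (metis proper_fractionsE)

lemma finite_poles: "finite {a. \<not> rf_regular_at a f}"
proof (cases f)
  case (Fract p q)
  then have "{a. \<not> rf_regular_at a f} \<subseteq> {a. poly q a = 0}"
    by (auto simp: rf_regular_at_def)
  then show ?thesis
    using poly_roots_finite[of q] Fract finite_subset by blast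
qed

text \<open>In lowest terms, regularity at a root of the denominator would make it a root of the
  numerator too, against coprimality. A denominator without complex roots is constant.\<close>

lemma polynomial_if_no_poles:
  assumes "\<And>a. rf_regular_at a f"
  obtains s where "f = Fract s 1"
proof -
  obtain p q where pq: "quot_of_fract f = (p, q)" "q \<noteq> 0" "f = Fract p q"
    by (rule ratfun_lowest_terms)
  have cop: "coprime p q"
    using coprime_quot_of_fract[of f] pq by simp
  have "poly q a \<noteq> 0" for a
  proof
    assume q: "poly q a = 0"
    obtain r s where "f = Fract r s" and nz: "poly s a \<noteq> 0"
      using assms[of a] by (auto simp: rf_regular_at_def)
    moreover have "s \<noteq> 0" using nz by auto
    ultimately have "p * s = r * q"
      using pq by (simp add: eq_fract)
    then have "poly p a * poly s a = 0"
      using q by (metis mult_zero_right poly_mult)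
    then have "[:- a, 1:] dvd p" "[:- a, 1:] dvd q"
      using nz q by (simp_all add: poly_eq_0_iff_dvd)
    with cop have "is_unit [:- a, 1:]" by (rule coprime_common_divisor)
    then show False by (auto simp: is_unit_iff_degree)
  qed
  then have "degree q = 0"
    using fundamental_theorem_of_algebra_alt[of q] by (metis degree_pCons_0)
  then obtain c where c: "q = [:c:]" "c \<noteq> 0"
    using pq(2) by (metis degree_eq_zeroE pCons_0_0)
  then have "f = Fract (smult (inverse c) p) 1"
    using pq by (simp add: eq_fract)
  then show thesis by (rule that)
qed


section \<open>The image of the difference operator\<close>

text \<open>Newton's method: falling factorials of step \<open>l\<close> behave under the difference
  as monomials do under the derivative, so leading terms can be removed by induction on the
  degree.\<close>

lemma translate_minus_id_surj:
  fixes l :: complex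
  assumes "l \<noteq> 0"
  shows "\<exists>s. pcompose s [:l, 1:] - s = p"
proof (induction "degree p" arbitrary: p rule: less_induct)
  case less
  show ?case
  proof (cases "p = 0")
    case True
    then show ?thesis by (intro exI[of _ 0]) simp
  next
    case False
    define fall where "fall n = (\<Prod>i<n. [:- (of_nat i * l), 1:])" for n :: nat
    define n where "n = degree p"
    \<comment> \<open>Translation turns factor \<open>i + 1\<close> into factor \<open>i\<close>,
      and the factor of index 0 into \<open>x + l\<close>.\<close>
    have shift_fall: "pcompose (fall (Suc m)) [:l, 1:] = [:l, 1:] * fall m" for m
    proof -
      have "pcompose [:- (of_nat (Suc i) * l), 1:] [:l, 1:] = [:- (of_nat i * l), 1:]" for i
        by (simp add: pcompose_pCons algebra_simps)
      moreover have "pcompose [:- (of_nat 0 * l), 1:] [:l, 1:] = [:l, 1:]"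
        by (simp add: pcompose_pCons)
      ultimately show ?thesis
        by (simp only: fall_def prod.lessThan_Suc_shift pcompose_mult pcompose_prod)
    qed
    have diff: "pcompose (fall (Suc n)) [:l, 1:] - fall (Suc n) = smult (of_nat (Suc n) * l) (fall n)"
    proof -
      have "pcompose (fall (Suc n)) [:l, 1:] - fall (Suc n)
          = ([:l, 1:] - [:- (of_nat n * l), 1:]) * fall n"
        unfolding shift_fall left_diff_distrib by (simp only: fall_def prod.lessThan_Suc mult.commute)
      also have "\<dots> = smult (of_nat (Suc n) * l) (fall n)"
        by (simp add: algebra_simps smult_add_left)
      finally show ?thesis .
    qed
    have deg: "degree (fall m) = m" for m
      by (simp add: fall_def degree_prod_eq_sum_degree)
    have lead: "lead_coeff (fall m) = 1" for m
      by (simp add: fall_def lead_coeff_prod)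
    \<comment> \<open>Chosen so that the difference of \<open>t\<close> has the leading term of
      \<open>p\<close>.\<close>
    define k where "k = lead_coeff p / (of_nat (Suc n) * l)"
    define t where "t = smult k (fall (Suc n))"
    have t: "pcompose t [:l, 1:] - t = smult (lead_coeff p) (fall n)"
    proof -
      have "k * (of_nat (Suc n) * l) = lead_coeff p"
        using assms unfolding k_def by (simp del: of_nat_Suc)
      then show ?thesis
        unfolding t_def pcompose_smult smult_diff_right[symmetric] diff smult_smult by simp
    qed
    show ?thesis
    proof (cases "n = 0")
      case True
      then obtain c where "p = [:c:]" by (metis n_def degree_eq_zeroE)
      then show ?thesis using t True by (intro exI[of _ t]) (simp add: fall_def)
    next
      case False
      define r where "r = p - smult (lead_coeff p) (fall n)"
      have "degree r \<le> n"
        unfolding r_def by (intro degree_diff_le) (auto simp: n_def deg)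
      moreover have "coeff r n = 0"
        using lead[of n] by (simp add: r_def n_def deg)
      ultimately have "degree r < n"
        using False by (metis coeff_0_degree_minus_1 diff_less le_neq_implies_less less_one
            degree_0 leading_coeff_0_iff not_gr_zero)
      then obtain s where "pcompose s [:l, 1:] - s = r"
        using less[of r] n_def by blast
      then have "pcompose (s + t) [:l, 1:] - (s + t) = p"
        using t by (simp add: r_def pcompose_add algebra_simps)
      then show ?thesis by blast
    qed
  qed
qed

text \<open>Telescoping over single shifts. Thus a fraction may be moved along its orbit modulo the
  image of the difference operator.\<close>

lemma rf_shift_int_minus_id:
  "\<exists>g. rf_shift (of_int n * l) f - f = rf_shift l g - g"
proof -
  have nat: "\<exists>g. rf_shift (of_nat m * l) f - f = rf_shift l g - g" for m f
  proof (induction m)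
    case 0
    then show ?case by (intro exI[of _ 0]) simp
  next
    case (Suc m)
    then obtain g where g: "rf_shift (of_nat m * l) f - f = rf_shift l g - g" by blast
    have "rf_shift (of_nat (Suc m) * l) f = rf_shift l (rf_shift (of_nat m * l) f)"
      by (simp add: rf_shift_rf_shift algebra_simps)
    then have "rf_shift (of_nat (Suc m) * l) f - f
        = (rf_shift l (rf_shift (of_nat m * l) f) - rf_shift (of_nat m * l) f)
          + (rf_shift (of_nat m * l) f - f)"
      by simp
    also have "\<dots> = rf_shift l (rf_shift (of_nat m * l) f + g) - (rf_shift (of_nat m * l) f + g)"
      unfolding g rf_shift_add by simp
    finally show ?case by blast
  qed
  show ?thesis
  proof (cases n)
    case (nonneg m)
    then show ?thesis using nat by simp
  next
    case (neg m)
    \<comment> \<open>For negative \<open>n\<close>, the forward shift by \<open>Suc m\<close> steps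
      takes \<open>h\<close> back to \<open>f\<close>; the natural case applies to \<open>h\<close>,
      up to sign.\<close>
    define h where "h = rf_shift (of_int n * l) f"
    have "rf_shift (of_nat (Suc m) * l) h = f"
      by (simp add: h_def neg rf_shift_rf_shift algebra_simps)
    then obtain g where "f - h = rf_shift l g - g"
      using nat[of "Suc m" h] by auto
    then have "h - f = rf_shift l (- g) - (- g)"
      using rf_shift_diff[of l 0 g] by (simp add: algebra_simps)
    then show ?thesis unfolding h_def by blast
  qed
qed

section \<open>Orbits of translation by \<open>l\<close>\<close>

text \<open>A set of representatives of \<open>\<complex> / l\<int>\<close>.\<close>
definition strip :: "complex \<Rightarrow> complex set" where
  "strip l = {a. 0 \<le> Re (a / l) \<and> Re (a / l) < 1}"

text \<open>Adding \<open>l\<close> to \<open>a\<close> raises \<open>Re (a / l)\<close> by 1, and a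
  half-open unit interval contains at most one point of each coset of the integers.\<close>

lemma strip_unique:
  assumes "l \<noteq> 0" "a + of_int m * l \<in> strip l" "a + of_int n * l \<in> strip l"
  shows "m = n"
proof -
  have "Re ((a + of_int k * l) / l) = Re (a / l) + of_int k" for k
    using assms(1) by (simp add: add_divide_distrib)
  then show ?thesis using assms(2,3) by (simp add: strip_def)
qed

lemma strip_exists:
  assumes "l \<noteq> 0"
  shows "\<exists>n. a + of_int n * l \<in> strip l"
proof
  have "Re ((a + of_int k * l) / l) = Re (a / l) + of_int k" for k
    using assms by (simp add: add_divide_distrib)
  from this[of "- \<lfloor>Re (a / l)\<rfloor>"] show "a + of_int (- \<lfloor>Re (a / l)\<rfloor>) * l \<in> strip l"
    unfolding strip_def mem_Collect_eq by linarith
qed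

lemma ex_extreme_int:
  fixes P :: "int \<Rightarrow> bool"
  assumes "finite {n. P n}" "P k"
  obtains m n where "P m" "P n" "m \<le> n" "\<not> P (m - 1)" "\<not> P (n + 1)"
proof
  show "P (Min {n. P n})" "P (Max {n. P n})"
    using Min_in[of "{n. P n}"] Max_in[of "{n. P n}"] assms by auto
  show "Min {n. P n} \<le> Max {n. P n}"
    using assms by (intro order.trans[OF Min_le[of "{n. P n}" k] Max_ge[of "{n. P n}" k]]) auto
  show "\<not> P (Min {n. P n} - 1)"
    using assms Min_le[of "{n. P n}" "Min {n. P n} - 1"] by fastforce
  show "\<not> P (Max {n. P n} + 1)"
    using assms Max_ge[of "{n. P n}" "Max {n. P n} + 1"] by fastforce
qed

text \<open>The extreme poles of \<open>g\<close> on an orbit of the shift produce two distinct poles of the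
  difference on this orbit, whereas the strip meets the orbit only once.\<close>
lemma difference_proper_fraction_eq_0:
  assumes l: "l \<noteq> 0" and mem: "rf_shift l g - g \<in> proper_fractions (strip l)"
  shows "rf_shift l g - g = 0"
proof -
  have "rf_regular_at a g" for a
  proof (rule ccontr)
    assume a: "\<not> rf_regular_at a g"
    define P where "P n \<longleftrightarrow> \<not> rf_regular_at (a + of_int n * l) g" for n
    have "inj (\<lambda>n::int. a + of_int n * l)"
      using l by (auto intro: injI)
    then have "finite {n. P n}"
      using finite_vimageI[OF finite_poles[of g], of "\<lambda>n. a + of_int n * l"]
      by (simp add: P_def vimage_def)
    moreover have "P 0" using a by (simp add: P_def)
    ultimately obtain m n where mn: "P m" "P n" "m \<le> n" "\<not> P (m - 1)" "\<not> P (n + 1)"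
      by (rule ex_extreme_int)
    define r where "r k \<longleftrightarrow> rf_regular_at (a + of_int k * l) (rf_shift l g - g)" for k
    have shift: "rf_regular_at (a + of_int k * l) (rf_shift l g) \<longleftrightarrow> \<not> P (k + 1)" for k
      by (simp add: rf_regular_at_shift P_def algebra_simps)
    \<comment> \<open>At the last pole \<open>n\<close> of \<open>g\<close>, the shifted
      \<open>g\<close> is regular because \<open>n + 1\<close> is no pole, so the pole of
      \<open>g\<close> survives in the difference.\<close>
    have "\<not> r n"
      using rf_regular_at_diff[of "a + of_int n * l" "rf_shift l g" "rf_shift l g - g"] mn shift[of n]
      by (auto simp: r_def P_def)
    \<comment> \<open>Just before the first pole \<open>m\<close>, \<open>g\<close> is regular while
      the shifted \<open>g\<close> has a pole.\<close>
    moreover have "\<not> r (m - 1)"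
      using rf_regular_at_add[of "a + of_int (m - 1) * l" "rf_shift l g - g" g] mn shift[of "m - 1"]
      by (auto simp: r_def P_def)
    ultimately have "a + of_int n * l \<in> strip l" "a + of_int (m - 1) * l \<in> strip l"
      using rf_regular_at_proper_fraction[OF mem] unfolding r_def by blast+
    then have "n = m - 1" using strip_unique[OF l] by blast
    then show False using mn by simp
  qed
  \<comment> \<open>Without poles \<open>g\<close> is a polynomial, so the difference is a
    polynomial and a proper fraction at once, hence zero.\<close>
  then obtain s where "g = Fract s 1" by (rule polynomial_if_no_poles)
  then have "rf_shift l g - g = Fract (pcompose s [:l, 1:] - s) 1"
    by (simp add: rf_shift_Fract)
  then show ?thesis
    using polynomial_proper_fraction_eq_0 mem by (metis Zero_fract_def)
qed

text \<open>The set \<open>S\<close> of fractions congruent to an element of \<open>E\<close> modulo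
  differences is closed under addition, so it suffices to place the summands of a partial fraction
  decomposition in it.\<close>

lemma difference_plus_proper_fractions:
  assumes l: "l \<noteq> 0"
  shows "\<exists>g. f - (rf_shift l g - g) \<in> proper_fractions (strip l)"
proof -
  define E where "E = proper_fractions (strip l)"
  define S where "S = {f. \<exists>g. f - (rf_shift l g - g) \<in> E}"
  have subspace: "rf.subspace E"
    using nonunitary_subalgebra_proper_fractions by (simp add: nonunitary_subalgebra_def E_def)
  have add: "f + h \<in> S" if fh: "f \<in> S" "h \<in> S" for f h
  proof -
    obtain a b where "f - (rf_shift l a - a) \<in> E" "h - (rf_shift l b - b) \<in> E"
      using fh by (auto simp: S_def)
    then have "f + h - (rf_shift l (a + b) - (a + b)) \<in> E"
      using rf.subspace_add[OF subspace] by (fastforce simp: rf_shift_add algebra_simps)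
    then show ?thesis unfolding S_def by blast
  qed
  have poly: "Fract s 1 \<in> S" for s
  proof -
    obtain t where t: "pcompose t [:l, 1:] - t = s"
      using translate_minus_id_surj[OF l] by blast
    have "Fract s 1 - (rf_shift l (Fract t 1) - Fract t 1) = 0"
      by (simp add: rf_shift_Fract flip: t)
    then show ?thesis
      unfolding S_def using rf.subspace_0[OF subspace] by (metis (mono_tags) mem_Collect_eq)
  qed
  \<comment> \<open>Division with remainder leaves a polynomial, which is a difference, and a proper
    part in \<open>E\<close>.\<close>
  have strip: "Fract p q \<in> S" if q: "q \<noteq> 0" "\<And>a. poly q a = 0 \<Longrightarrow> a \<in> strip l" for p q
  proof -
    have "Fract (p mod q) q \<in> E"
      unfolding E_def using q degree_mod_less[of q p] by (intro Fract_in_proper_fractions) auto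
    then have "Fract (p mod q) q \<in> S"
      unfolding S_def by (auto intro!: exI[of _ 0])
    moreover have "Fract p q = Fract (p div q) 1 + Fract (p mod q) q"
      using q(1) by (simp add: eq_fract)
    ultimately show ?thesis using add poly by simp
  qed
  have linear_power: "Fract p ([:- a, 1:] ^ k) \<in> S" for p a k
  proof -
    obtain n where n: "a + of_int n * l \<in> strip l"
      using strip_exists[OF l] by blast
    \<comment> \<open>Substituting \<open>x - n l\<close> for \<open>x\<close> moves the only
      possible pole from \<open>a\<close> to \<open>a + n l\<close>, inside the strip; hence the
      minus sign.\<close>
    define h where "h = rf_shift (of_int (- n) * l) (Fract p ([:- a, 1:] ^ k))"
    define q where "q = pcompose ([:- a, 1:] ^ k) [:of_int (- n) * l, 1:]"
    have "x \<in> strip l" if "poly q x = 0" for x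
    proof -
      have "x = a + of_int n * l"
        using that by (simp add: q_def poly_pcompose algebra_simps)
      then show ?thesis using n by simp
    qed
    moreover have "q \<noteq> 0" by (simp add: q_def)
    ultimately have "h \<in> S"
      unfolding h_def by (subst rf_shift_Fract) (simp, fold q_def, blast intro: strip)
    then obtain u where u: "h - (rf_shift l u - u) \<in> E" by (auto simp: S_def)
    obtain v where v: "h - Fract p ([:- a, 1:] ^ k) = rf_shift l v - v"
      using rf_shift_int_minus_id[of "- n" l] unfolding h_def by blast
    have "Fract p ([:- a, 1:] ^ k) = h - (rf_shift l v - v)"
      using v by (simp add: algebra_simps)
    then have "Fract p ([:- a, 1:] ^ k) - (rf_shift l (u - v) - (u - v)) \<in> E"
      using u by (simp add: rf_shift_diff algebra_simps)
    then show ?thesis unfolding S_def by blast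
  qed
  have "Fract p q \<in> S" if "q \<noteq> 0" for p q
    using that
  proof (induction "degree q" arbitrary: p q rule: less_induct)
    case less
    show ?case
    proof (cases "degree q = 0")
      case True
      then obtain c where c: "q = [:c:]" by (rule degree_eq_zeroE)
      with less(2) have "c \<noteq> 0" by auto
      then show ?thesis by (intro strip) (auto simp: c)
    next
      case False
      then obtain a where a: "poly q a = 0"
        using fundamental_theorem_of_algebra_alt[of q] by (metis degree_pCons_0)
      \<comment> \<open>Splitting off the full power of the linear factor leaves a cofactor
        \<open>r\<close> coprime to it and of smaller degree; a Bezout identity then separates the
        two denominators.\<close>
      obtain r where r: "q = [:- a, 1:] ^ order a q * r" "\<not> [:- a, 1:] dvd r"
        using order_decomp[OF less(2)] by blast
      define w where "w = [:- a, 1:] ^ order a q"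
      have "order a q \<noteq> 0" using a less(2) by (simp add: order_root)
      moreover have "r \<noteq> 0" using r(2) by auto
      ultimately have "degree r < degree q"
        by (subst r(1)) (simp add: degree_mult_eq degree_power_eq)
      have "prime_elem [:- a, 1:]"
        by (intro prime_elem_linear_field_poly) simp_all
      with r(2) have "coprime [:- a, 1:] r"
        by (simp add: prime_elem_imp_coprime)
      then have "coprime w r"
        by (simp add: w_def)
      then obtain u v where uv: "u * w + v * r = 1"
        using bezout_coefficients_fst_snd[of w r] by (metis coprime_imp_gcd_eq_1)
      have "w \<noteq> 0" by (simp add: w_def)
      have "p * (u * w + v * r) = p * v * r + p * u * w"
        by (simp add: algebra_simps)
      then have "Fract p (w * r) = Fract (p * v) w + Fract (p * u) r"
        using uv \<open>w \<noteq> 0\<close> \<open>r \<noteq> 0\<close> by simp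
      moreover have "Fract (p * u) r \<in> S"
        using less(1) \<open>degree r < degree q\<close> \<open>r \<noteq> 0\<close> by blast
      moreover have "Fract (p * v) w \<in> S"
        unfolding w_def by (rule linear_power)
      ultimately show ?thesis
        using add r(1) unfolding w_def by simp
    qed
  qed
  then have "f \<in> S" by (cases f) simp
  then show ?thesis by (simp add: S_def E_def)
qed

section \<open>Regularity of the derivations\<close>

lemma regular_rf_d: "regular_differential_algebra rf_scale l (rf_d l)"
proof -
  have d: "module_hom rf_scale rf_scale (rf_d l)"
    using differential_algebra_rf_d[of l] by (simp add: differential_algebra_def derivation_def)
  show ?thesis
  proof (cases "l = 0")
    case True
    then show ?thesis
      using differential_algebra_rf_d quasi_inverse_exists[OF rf.vector_space_axioms d]
      by (simp add: regular_differential_algebra_def)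
  next
    case False
    define E where "E = proper_fractions (strip l)"
    have alg: "nonunitary_subalgebra rf_scale E"
      unfolding E_def by (rule nonunitary_subalgebra_proper_fractions)
    then have subspace: "rf.subspace E" by (simp add: nonunitary_subalgebra_def)
    have rf_d: "rf_scale l (rf_d l g) = rf_shift l g - g" for g
      using False by (simp add: rf_d_def)
    have "\<exists>y. x - rf_d l y \<in> E" for x
    proof -
      obtain g where "x - (rf_shift l g - g) \<in> E"
        using difference_plus_proper_fractions[OF False] unfolding E_def by blast
      \<comment> \<open>Scaling \<open>g\<close> by \<open>l\<close> cancels the factor
        \<open>inverse l\<close> in \<open>rf_d l\<close>.\<close>
      then have "x - rf_d l (rf_scale l g) \<in> E"
        by (simp add: module_hom.scale[OF d] rf_d)
      then show ?thesis by blast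
    qed
    moreover have "rf_d l y = 0" if y: "rf_d l y \<in> E" for y
    proof -
      have "rf_shift l y - y \<in> E"
        using rf.subspace_scale[OF subspace y, of l] by (simp add: rf_d)
      then have "rf_scale l (rf_d l y) = 0"
        using difference_proper_fraction_eq_0[OF False] by (simp add: E_def rf_d)
      then show ?thesis using False by simp
    qed
    ultimately obtain q where "quasi_inverse rf_scale rf_scale (rf_d l) q" "{x. q x = 0} = E"
      using quasi_inverse_with_kernel[OF rf.vector_space_axioms d subspace] by blast
    then show ?thesis
      using differential_algebra_rf_d alg by (auto simp: regular_differential_algebra_def)
  qed
qed

theorem proposition4p12:
  shows "(\<forall>l::complex. regular_differential_algebra rf_scale l (rf_d l))
    \<and> regular_differential_algebra rf_scale 1 (\<lambda>f. rf_shift 1 f - f)"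
proof -
  have "rf_d 1 = (\<lambda>f. rf_shift 1 f - f)"
    by (simp add: rf_d_def fun_eq_iff)
  then show ?thesis using regular_rf_d[of 1] regular_rf_d by simp
qed

end
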